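(* There exist absolute constants $c > 0$ and $D_0$ such that the following holds. Let $K > 2$ and $\varepsilon \in (0,1/2)$, and put $D := \varepsilon^{-1}\min(K-2,1)$; suppose $D \geq D_0$. Suppose $\delta > 0$ has the following property: for all finite $A, B \subset \mathbb{Z}$ with $|A| = |B| = N$ and every $\Gamma \subset A \times B$ with $|\Gamma| \geq (1-\delta)N^2$ and $|A+_{\Gamma}B| \leq KN$, there exist $A' \subset A$, $B' \subset B$ with $|A'| \geq (1-\varepsilon)N$, $|B'| \geq (1-\varepsilon)N$ and $|A'+B'| \leq |A+_{\Gamma}B| + \varepsilon N$. Then \[ \delta \leq \exp\left(-c (\log D)^2 (\log\log D)^{-2}\right). \]
   Context: For $A,B \subset \mathbb{Z}$ and $\Gamma \subset A \times B$, the restricted sumset is $A +_{\Gamma} B = \{a+b : (a,b) \in \Gamma\}$. *)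

theory Defs
  imports Complex_Main "HOL-Library.Set_Algebras"
begin

text \<open>
  The restricted sumset of \<open>A\<close> and \<open>B\<close> along \<open>\<Gamma> \<subseteq> A \<times> B\<close>. It depends on \<open>\<Gamma>\<close> only, so
  \<open>A\<close> and \<open>B\<close> are not arguments. Full sumsets are written \<open>A + B\<close>, with the addition of sets
  from \<open>HOL-Library.Set_Algebras\<close>.
\<close>

definition restricted_sumset :: "(int \<times> int) set \<Rightarrow> int set"
  where "restricted_sumset \<Gamma> = {a + b | a b. (a, b) \<in> \<Gamma>}"

end

theory Submission
  imports Defs
begin

text \<open>
  Let \<open>X \<subseteq> [0, M)\<close> be a Behrend set, free of three-term progressions, and attach a translate \<open>Y\<close> of \<open>X\<close>
  beyond the end of a long interval to get \<open>A\<^sub>0\<close>. An element \<open>2y\<close> with \<open>y \<in> Y\<close> has \<open>y + y\<close> as its only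
  representation in \<open>A\<^sub>0 + A\<^sub>0\<close>, so deleting the few diagonal pairs \<open>(y, y)\<close> from \<open>A\<^sub>0 \<times> A\<^sub>0\<close> removes
  \<open>|X|\<close> sums. Deleting a few elements of \<open>A\<^sub>0\<close> might destroy even more sums; to exclude this, \<open>(A\<^sub>0, A\<^sub>0)\<close>
  is replaced by a pair \<open>(A, B)\<close> of equally large subsets that minimises \<open>|A + B| - 18 Q |A|\<close>, where
  \<open>Q = M / |X|\<close>. Minimality bounds the loss of sums under further deletions by \<open>18 Q\<close> per element,
  and the trivial bound \<open>|A + B| \<ge> 2|A| - 1\<close> shows that only a small part of \<open>Y\<close> is missing
  from \<open>A\<close> and \<open>B\<close>.
\<close>

section \<open>Sumsets of integers\<close>

text \<open>The translates \<open>A + Min B\<close> and \<open>Max A + B\<close> both lie in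
  \<open>A + B\<close>, one to the left and one to the right of \<open>Max A + Min B\<close>, which
  is their only common element.\<close>

lemma card_set_plus_int_ge:
  fixes A B :: "int set"
  assumes "finite A" "finite B" "A \<noteq> {}" "B \<noteq> {}"
  shows "card A + card B \<le> card (A + B) + 1"
proof -
  let ?P = "(\<lambda>a. a + Min B) ` A" and ?Q = "(\<lambda>b. Max A + b) ` B"
  have sub: "?P \<union> ?Q \<subseteq> A + B"
    using Max_in[OF assms(1,3)] Min_in[OF assms(2,4)] by (auto intro: set_plus_intro)
  have "x = Max A + Min B" if "x \<in> ?P \<inter> ?Q" for x
  proof -
    obtain a b where "a \<in> A" "b \<in> B" "x = a + Min B" "x = Max A + b"
      using \<open>x \<in> ?P \<inter> ?Q\<close> by auto
    moreover have "a \<le> Max A" "Min B \<le> b"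
      using assms calculation by auto
    ultimately show ?thesis by linarith
  qed
  then have "card (?P \<inter> ?Q) \<le> card {Max A + Min B}"
    by (intro card_mono) auto
  moreover have "card ?P + card ?Q = card (?P \<union> ?Q) + card (?P \<inter> ?Q)"
    using assms by (intro card_Un_Int) auto
  moreover have "card (?P \<union> ?Q) \<le> card (A + B)"
    using sub assms by (intro card_mono finite_set_plus) auto
  moreover have "card ?P = card A" "card ?Q = card B"
    by (auto intro!: card_image inj_onI)
  ultimately show ?thesis by simp
qed

section \<open>Progression-free sets of Behrend type\<close>

lemma int_digits_unique:
  fixes m u u' t t' :: int
  assumes "m * u + t = m * u' + t'" "0 \<le> t" "t < m" "0 \<le> t'" "t' < m"
  shows "u = u' \<and> t = t'"
proof -
  have "u = (m * u + t) div m" using assms(2,3) by simp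
  also have "\<dots> = (m * u' + t') div m" by (simp only: assms(1))
  also have "\<dots> = u'" using assms(4,5) by simp
  finally have "u = u'" .
  with assms(1) show ?thesis by simp
qed

text \<open>
  The elements of \<open>F\<close> encode the points \<open>(v, |v|\<^sup>2)\<close> with \<open>v \<in> {0..<n}\<^sup>d\<close>, where \<open>v\<close> is written in
  base \<open>2n\<close>; since digits stay below \<open>n\<close>, adding two codes produces no carry.
\<close>

lemma paraboloid_code:
  fixes n :: nat
  shows "\<exists>F :: (int \<times> int) set. finite F \<and> card F = n ^ d \<and> inj_on fst F \<and>
    (\<forall>u q. (u, q) \<in> F \<longrightarrow>
       0 \<le> u \<and> 2 * u < (2 * int n) ^ d \<and> 0 \<le> q \<and> q \<le> int (d * n\<^sup>2)) \<and>
    (\<forall>u q u' q' v p. (u, q) \<in> F \<longrightarrow> (u', q') \<in> F \<longrightarrow> (v, p) \<in> F \<longrightarrow> u + u' = 2 * v \<longrightarrow>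
       2 * p \<le> q + q' \<and> (q + q' = 2 * p \<longrightarrow> u = u'))"
proof (induction d)
  case 0
  show ?case by (rule exI[of _ "{(0, 0)}"]) auto
next
  case (Suc d)
  then obtain F :: "(int \<times> int) set" where F: "finite F" "card F = n ^ d" "inj_on fst F"
    and bounds: "\<And>u q. (u, q) \<in> F \<Longrightarrow>
      0 \<le> u \<and> 2 * u < (2 * int n) ^ d \<and> 0 \<le> q \<and> q \<le> int (d * n\<^sup>2)"
    and conv: "\<And>u q u' q' v p. (u, q) \<in> F \<Longrightarrow> (u', q') \<in> F \<Longrightarrow> (v, p) \<in> F \<Longrightarrow> u + u' = 2 * v \<Longrightarrow>
       2 * p \<le> q + q' \<and> (q + q' = 2 * p \<longrightarrow> u = u')"
    by (elim exE conjE) blast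
  \<comment> \<open>A new coordinate \<open>t\<close> is appended as the lowest digit in base
    \<open>2 * n\<close>, and its square is added to the squared norm.\<close>
  define f where "f = (\<lambda>((u, q), t). (2 * int n * u + t, q + t\<^sup>2 :: int))"
  let ?G = "F \<times> {0..<int n}"
  note digits = int_digits_unique[of "2 * int n"]
  have inj: "inj_on (fst \<circ> f) ?G"
  proof (rule inj_onI, clarsimp simp: f_def)
    fix u q t u' q' t'
    assume *: "(u, q) \<in> F" "(u', q') \<in> F" "0 \<le> t" "t < int n" "0 \<le> t'" "t' < int n"
      "2 * int n * u + t = 2 * int n * u' + t'"
    then have "u = u' \<and> t = t'" by (intro digits) auto
    moreover from this have "q = q'" using inj_onD[OF F(3), of "(u, q)" "(u', q')"] * by auto
    ultimately show "u = u' \<and> q = q' \<and> t = t'" by simp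
  qed
  have "card (f ` ?G) = n ^ Suc d"
    using inj_on_imageI2[OF inj] F(2) by (simp add: card_image card_cartesian_product)
  moreover have "inj_on fst (f ` ?G)"
    by (rule inj_on_imageI[OF inj])
  moreover have "0 \<le> u \<and> 2 * u < (2 * int n) ^ Suc d \<and> 0 \<le> q \<and> q \<le> int (Suc d * n\<^sup>2)"
    if mem: "(u, q) \<in> f ` ?G" for u q
  proof -
    obtain v p t where *: "(v, p) \<in> F" "0 \<le> t" "t < int n" "u = 2 * int n * v + t" "q = p + t\<^sup>2"
      using mem by (auto simp: f_def)
    \<comment> \<open>Integrality of the strict bound leaves room for the new digit, since
      \<open>2 * t < 2 * n\<close>.\<close>
    have "2 * v + 1 \<le> (2 * int n) ^ d" using bounds[OF *(1)] by simp
    then have "2 * int n * (2 * v + 1) \<le> 2 * int n * (2 * int n) ^ d"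
      by (intro mult_left_mono) auto
    moreover have "2 * u < 2 * int n * (2 * v + 1)" using * by (simp add: algebra_simps)
    moreover have "t\<^sup>2 \<le> (int n)\<^sup>2" using * by (intro power_mono) auto
    moreover have "int (Suc d * n\<^sup>2) = int (d * n\<^sup>2) + (int n)\<^sup>2" by simp
    moreover have "0 \<le> 2 * int n * v" "0 \<le> t\<^sup>2" using bounds[OF *(1)] by auto
    moreover have "(2 * int n) ^ Suc d = 2 * int n * (2 * int n) ^ d" by simp
    ultimately show ?thesis using * bounds[OF *(1)] by linarith
  qed
  moreover have "2 * p \<le> q + q' \<and> (q + q' = 2 * p \<longrightarrow> u = u')"
    if mem: "(u, q) \<in> f ` ?G" "(u', q') \<in> f ` ?G" "(v, p) \<in> f ` ?G" and sum: "u + u' = 2 * v" for u q u' q' v p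
  proof -
    obtain u0 q0 t where 1: "(u0, q0) \<in> F" "0 \<le> t" "t < int n" "u = 2 * int n * u0 + t" "q = q0 + t\<^sup>2"
      using mem by (auto simp: f_def)
    obtain u1 q1 t' where 2: "(u1, q1) \<in> F" "0 \<le> t'" "t' < int n" "u' = 2 * int n * u1 + t'"
      "q' = q1 + t'\<^sup>2"
      using mem by (auto simp: f_def)
    obtain v0 p0 s where 3: "(v0, p0) \<in> F" "0 \<le> s" "s < int n" "v = 2 * int n * v0 + s" "p = p0 + s\<^sup>2"
      using mem by (auto simp: f_def)
    have "2 * int n * (u0 + u1) + (t + t') = 2 * int n * (2 * v0) + 2 * s"
      using sum 1 2 3 by (simp add: algebra_simps)
    then have eq: "u0 + u1 = 2 * v0 \<and> t + t' = 2 * s"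
      by (rule digits) (use 1 2 3 in auto)
    have c: "2 * p0 \<le> q0 + q1 \<and> (q0 + q1 = 2 * p0 \<longrightarrow> u0 = u1)"
      using conv[OF 1(1) 2(1) 3(1)] eq by simp
    \<comment> \<open>Strict convexity of the square, by the parallelogram law:
      \<open>t\<^sup>2 + t'\<^sup>2\<close> exceeds \<open>2 * s\<^sup>2\<close> by half of
      \<open>(t - t')\<^sup>2\<close>. Added to the inequality for the other digits, equality in the
      sum forces equality in both.\<close>
    have "2 * (t\<^sup>2 + t'\<^sup>2) = (t + t')\<^sup>2 + (t - t')\<^sup>2" by (simp add: power2_eq_square algebra_simps)
    also have "\<dots> = 4 * s\<^sup>2 + (t - t')\<^sup>2" using eq by (simp add: power2_eq_square)
    finally have sq: "2 * (t\<^sup>2 + t'\<^sup>2) = 4 * s\<^sup>2 + (t - t')\<^sup>2" .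
    have "2 * c \<le> e \<and> (e = 2 * c \<longrightarrow> r = 0)" if "2 * e = 4 * c + r" "0 \<le> r" for c e r :: int
      using that by linarith
    from this[OF sq] have "2 * s\<^sup>2 \<le> t\<^sup>2 + t'\<^sup>2 \<and> (t\<^sup>2 + t'\<^sup>2 = 2 * s\<^sup>2 \<longrightarrow> t = t')" by simp
    moreover have "q + q' = (q0 + q1) + (t\<^sup>2 + t'\<^sup>2)" "2 * p = 2 * p0 + 2 * s\<^sup>2" using 1 2 3 by auto
    ultimately show ?thesis using c 1(4) 2(4) by (smt (verit))
  qed
  ultimately show ?case using F(1) by (intro exI[of _ "f ` ?G"] conjI allI impI; blast)
qed

text \<open>The squared norm \<open>q\<close> is placed as a leading digit above the code
  \<open>u\<close>. A three-term progression then projects to one in \<open>u\<close> and one in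
  \<open>q\<close>, and a strictly convex paraboloid contains no midpoint of two of its distinct
  points. All \<open>n ^ d\<close> grid points are kept, instead of those on one popular sphere; the
  price is the factor \<open>d * n\<^sup>2 + 1\<close> in the length of the interval.\<close>

lemma behrend_set:
  fixes n d :: nat
  obtains X :: "int set" where "finite X" "card X = n ^ d"
    "X \<subseteq> {0..<int ((2 * n) ^ d * (d * n\<^sup>2 + 1))}"
    "\<And>x y z. x \<in> X \<Longrightarrow> y \<in> X \<Longrightarrow> z \<in> X \<Longrightarrow> x + y = 2 * z \<Longrightarrow> x = y"
proof -
  obtain F :: "(int \<times> int) set" where F: "finite F" "card F = n ^ d" "inj_on fst F"
    and bounds: "\<And>u q. (u, q) \<in> F \<Longrightarrow>
      0 \<le> u \<and> 2 * u < (2 * int n) ^ d \<and> 0 \<le> q \<and> q \<le> int (d * n\<^sup>2)"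
    and conv: "\<And>u q u' q' v p. (u, q) \<in> F \<Longrightarrow> (u', q') \<in> F \<Longrightarrow> (v, p) \<in> F \<Longrightarrow> u + u' = 2 * v \<Longrightarrow>
       2 * p \<le> q + q' \<and> (q + q' = 2 * p \<longrightarrow> u = u')"
    using paraboloid_code[of n d] by (elim exE conjE) blast
  define m where "m = (2 * int n) ^ d"
  define g where "g = (\<lambda>(u, q). m * q + u :: int)"
  note digits = int_digits_unique[of m]
  have inj: "inj_on g F"
  proof (rule inj_onI, clarify)
    fix u q u' q'
    assume *: "(u, q) \<in> F" "(u', q') \<in> F" "g (u, q) = g (u', q')"
    then show "u = u' \<and> q = q'"
      using digits[of q u q' u'] bounds[OF *(1)] bounds[OF *(2)] by (simp add: g_def m_def)
  qed
  have range: "g ` F \<subseteq> {0..<int ((2 * n) ^ d * (d * n\<^sup>2 + 1))}"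
  proof clarify
    fix u q assume "(u, q) \<in> F"
    note b = bounds[OF this, folded m_def]
    then have "m * q \<le> m * int (d * n\<^sup>2)" "0 \<le> m * q" by (auto intro!: mult_left_mono)
    moreover have "int ((2 * n) ^ d * (d * n\<^sup>2 + 1)) = m * int (d * n\<^sup>2) + m"
      by (simp add: m_def algebra_simps)
    ultimately show "g (u, q) \<in> {0..<int ((2 * n) ^ d * (d * n\<^sup>2 + 1))}"
      using b unfolding g_def prod.case atLeastLessThan_iff by linarith
  qed
  have free: "x = y" if mem: "x \<in> g ` F" "y \<in> g ` F" "z \<in> g ` F" and sum: "x + y = 2 * z" for x y z
  proof -
    obtain u q where 1: "(u, q) \<in> F" "x = m * q + u" using mem by (auto simp: g_def)
    obtain u' q' where 2: "(u', q') \<in> F" "y = m * q' + u'" using mem by (auto simp: g_def)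
    obtain v p where 3: "(v, p) \<in> F" "z = m * p + v" using mem by (auto simp: g_def)
    note b = bounds[OF 1(1), folded m_def] bounds[OF 2(1), folded m_def] bounds[OF 3(1), folded m_def]
    have "m * (q + q') + (u + u') = m * (2 * p) + 2 * v"
      using sum 1 2 3 by (simp add: algebra_simps)
    \<comment> \<open>The factor 2 in the bound \<open>2 * u < m\<close> keeps \<open>u + u'\<close>
      and \<open>2 * v\<close> below \<open>m\<close>, so nothing is carried into the leading
      digit.\<close>
    then have eq: "q + q' = 2 * p \<and> u + u' = 2 * v" by (rule digits) (use b in auto)
    then have "u = u'" using conv[OF 1(1) 2(1) 3(1)] by simp
    then show "x = y" using inj_onD[OF F(3) _ 1(1) 2(1)] 1 2 by simp
  qed
  show ?thesis
    by (rule that[OF _ _ range free]) (use F inj in \<open>auto simp: card_image\<close>)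
qed

section \<open>The extremal pair and its failure of regularity\<close>

text \<open>A minimum over finitely many pairs. It is used twice: comparison with
  \<open>(A0, B0)\<close> limits how much was removed, and comparison with subsets of
  \<open>A\<close> and \<open>B\<close> shows that each further removed element costs at most
  \<open>w\<close> sums.\<close>

lemma penalised_sumset_minimiser:
  fixes A0 B0 :: "int set" and w :: real
  assumes "finite A0" "finite B0" "card A0 = card B0"
  obtains A B where "A \<subseteq> A0" "B \<subseteq> B0" "card A = card B"
    "\<And>A' B'. A' \<subseteq> A0 \<Longrightarrow> B' \<subseteq> B0 \<Longrightarrow> card A' = card B' \<Longrightarrow>
      real (card (A + B)) - w * real (card A) \<le> real (card (A' + B')) - w * real (card A')"
proof -
  let ?S = "{p \<in> Pow A0 \<times> Pow B0. card (fst p) = card (snd p)}"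
  let ?\<Phi> = "\<lambda>p. real (card (fst p + snd p)) - w * real (card (fst p))"
  have "finite ?S" "?S \<noteq> {}" using assms by auto
  then obtain p where "is_arg_min ?\<Phi> (\<lambda>p. p \<in> ?S) p"
    using ex_is_arg_min_if_finite[of ?S ?\<Phi>] by blast
  then have "p \<in> ?S" "\<And>r. r \<in> ?S \<Longrightarrow> ?\<Phi> p \<le> ?\<Phi> r"
    by (auto simp: is_arg_min_linorder)
  then show ?thesis
    by (intro that[of "fst p" "snd p"]) force+
qed

text \<open>The property that the theorem assumes of \<open>\<delta>\<close>, named so that it can
  be refuted for large \<open>\<delta>\<close>.\<close>

definition robust_regularity :: "real \<Rightarrow> real \<Rightarrow> real \<Rightarrow> bool" where
  "robust_regularity K \<epsilon> \<delta> \<longleftrightarrow>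
     (\<forall>(N::nat) (A::int set) (B::int set) (\<Gamma>::(int \<times> int) set).
        finite A \<longrightarrow> finite B \<longrightarrow> card A = N \<longrightarrow> card B = N \<longrightarrow>
        \<Gamma> \<subseteq> A \<times> B \<longrightarrow>
        real (card \<Gamma>) \<ge> (1 - \<delta>) * (real N)\<^sup>2 \<longrightarrow>
        real (card (restricted_sumset \<Gamma>)) \<le> K * real N \<longrightarrow>
        (\<exists>A' B'. A' \<subseteq> A \<and> B' \<subseteq> B \<and>
           real (card A') \<ge> (1 - \<epsilon>) * real N \<and>
           real (card B') \<ge> (1 - \<epsilon>) * real N \<and>
           real (card (A' + B')) \<le> real (card (restricted_sumset \<Gamma>)) + \<epsilon> * real N))"

text \<open>The larger of the two sets is trimmed to the size of the smaller, because the minimiser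
  competes only with pairs of equal cardinality.\<close>

lemma robust_regularity_equal_cards:
  assumes "robust_regularity K \<epsilon> \<delta>" "finite A" "finite B" "card A = card B" "\<Gamma> \<subseteq> A \<times> B"
    "real (card \<Gamma>) \<ge> (1 - \<delta>) * (real (card A))\<^sup>2"
    "real (card (restricted_sumset \<Gamma>)) \<le> K * real (card A)"
  obtains A' B' where "A' \<subseteq> A" "B' \<subseteq> B" "card A' = card B'"
    "real (card A') \<ge> (1 - \<epsilon>) * real (card A)"
    "real (card (A' + B')) \<le> real (card (restricted_sumset \<Gamma>)) + \<epsilon> * real (card A)"
proof -
  obtain A1 B1 where 1: "A1 \<subseteq> A" "B1 \<subseteq> B"
    "real (card A1) \<ge> (1 - \<epsilon>) * real (card A)" "real (card B1) \<ge> (1 - \<epsilon>) * real (card A)"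
    "real (card (A1 + B1)) \<le> real (card (restricted_sumset \<Gamma>)) + \<epsilon> * real (card A)"
    using assms unfolding robust_regularity_def by metis
  define k where "k = min (card A1) (card B1)"
  obtain A' where A': "A' \<subseteq> A1" "card A' = k"
    using obtain_subset_with_card_n[of k A1] by (auto simp: k_def)
  obtain B' where B': "B' \<subseteq> B1" "card B' = k"
    using obtain_subset_with_card_n[of k B1] by (auto simp: k_def)
  have "finite (A1 + B1)"
    using 1 assms by (meson finite_set_plus finite_subset)
  then have "card (A' + B') \<le> card (A1 + B1)"
    using A' B' by (intro card_mono set_plus_mono2)
  then show ?thesis
    using 1 A' B' by (intro that[of A' B']) (auto simp: k_def min_def)
qed

text \<open>Here \<open>1 / Q\<close> is the density of \<open>X\<close> in its interval and
  \<open>\<sigma>\<close> is the room that \<open>K\<close> leaves above the doubling constant 2.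
  The bound on \<open>\<epsilon>\<close> makes the sums lost by passing to subsets fewer than
  \<open>card X / 2\<close>, while deleting the diagonal pairs loses at least that many; the bound
  on \<open>\<delta>\<close> permits this deletion.\<close>

lemma not_robust_regularity:
  fixes X :: "int set" and M Q :: nat and K \<epsilon> \<delta> \<sigma> :: real
  assumes X: "finite X" "X \<noteq> {}" "X \<subseteq> {0..<int M}" "M = Q * card X"
    and free: "\<And>x y z. x \<in> X \<Longrightarrow> y \<in> X \<Longrightarrow> z \<in> X \<Longrightarrow> x + y = 2 * z \<Longrightarrow> x = y"
    and K: "0 < \<sigma>" "\<sigma> \<le> 1" "2 + \<sigma> \<le> K" and \<epsilon>: "0 < \<epsilon>" "256 * (real Q)\<^sup>2 * \<epsilon> \<le> \<sigma>"
    and \<delta>: "1 \<le> \<delta> * real M"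
  shows "\<not> robust_regularity K \<epsilon> \<delta>"
proof
  assume reg: "robust_regularity K \<epsilon> \<delta>"
  have cX: "card X \<ge> 1" using X by (simp add: Suc_leI card_gt_0_iff)
  have "M \<ge> 1" using X(2,3) by (cases M) auto
  then have Q: "Q \<ge> 1" using X by (cases Q) auto
  have cXM: "card X \<le> M" using X(4) Q by simp
  \<comment> \<open>The least length with \<open>4 * M \<le> \<sigma> * L\<close>, so that the
    \<open>2 * L + 4 * M\<close> possible sums number at most
    \<open>(2 + \<sigma>) * L\<close>.\<close>
  define L where "L = nat \<lceil>4 * real M / \<sigma>\<rceil>"
  have L: "4 * real M / \<sigma> \<le> real L" "real L \<le> 4 * real M / \<sigma> + 1"
    using K unfolding L_def by (auto simp: of_nat_ceiling intro!: divide_nonneg_pos)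
  have M_le: "4 * real M \<le> \<sigma> * real L" using L(1) K by (simp add: field_simps)
  have "\<sigma> * real L \<le> real L" using K by (simp add: mult_left_le_one_le)
  then have M_le': "4 * M \<le> L" using M_le by linarith
  have M\<sigma>: "real M \<le> real M / \<sigma>" "1 \<le> real M / \<sigma>"
    using K \<open>M \<ge> 1\<close> by (auto simp: le_divide_eq mult_left_le)
  \<comment> \<open>The gap of length \<open>M\<close> after the interval matters: if
    \<open>a + b = 2 * t\<close> with \<open>t\<close> in \<open>Y\<close>, then
    \<open>b < L + 2 * M\<close> forces \<open>a > L\<close>, and likewise for \<open>b\<close>, so
    both summands lie in \<open>Y\<close>.\<close>
  define Y where "Y = (\<lambda>x. int (L + M) + x) ` X"
  have Y: "finite Y" "card Y = card X" "Y \<subseteq> {int (L + M)..<int (L + 2 * M)}"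
    using X by (auto simp: Y_def intro!: card_image inj_onI)
  define A0 where "A0 = {0..<int L} \<union> Y"
  have A0: "finite A0" "A0 \<subseteq> {0..<int (L + 2 * M)}" using Y by (auto simp: A0_def)
  have "{0..<int L} \<inter> Y = {}" using Y(3) by force
  then have cA0: "card A0 = L + card X" using Y by (simp add: A0_def card_Un_disjoint)
  have unique: "a = t \<and> b = t" if "a \<in> A0" "b \<in> A0" "t \<in> Y" and sum: "a + b = 2 * t" for a b t
  proof -
    have "a < int (L + 2 * M)" "b < int (L + 2 * M)" "t \<ge> int (L + M)"
      using that A0(2) Y(3) by force+
    then have "a \<ge> int L" "b \<ge> int L" using sum by auto
    then have "a \<in> Y" "b \<in> Y" using that by (auto simp: A0_def)
    then obtain x y z where xyz: "x \<in> X" "y \<in> X" "z \<in> X"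
      "a = int (L + M) + x" "b = int (L + M) + y" "t = int (L + M) + z"
      using \<open>t \<in> Y\<close> by (auto simp: Y_def)
    then have "x + y = 2 * z" using sum by simp
    with xyz show ?thesis using free[OF xyz(1-3)] by simp
  qed
  have sumA0: "card (A0 + A0) \<le> 2 * L + 4 * M"
  proof -
    have "A0 + A0 \<subseteq> {0..<int (2 * L + 4 * M)}"
    proof
      fix s assume "s \<in> A0 + A0"
      then obtain a b where "a \<in> A0" "b \<in> A0" "s = a + b" by (rule set_plus_elim)
      moreover from this have "a \<in> {0..<int (L + 2 * M)}" "b \<in> {0..<int (L + 2 * M)}"
        using A0(2) by blast+
      ultimately show "s \<in> {0..<int (2 * L + 4 * M)}" by simp
    qed
    then have "card (A0 + A0) \<le> card {0..<int (2 * L + 4 * M)}" by (intro card_mono) auto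
    then show ?thesis by simp
  qed
  obtain A B where AB: "A \<subseteq> A0" "B \<subseteq> A0" "card A = card B"
    and minimal: "\<And>A' B'. A' \<subseteq> A0 \<Longrightarrow> B' \<subseteq> A0 \<Longrightarrow> card A' = card B' \<Longrightarrow>
      real (card (A + B)) - (18 * real Q) * real (card A)
        \<le> real (card (A' + B')) - (18 * real Q) * real (card A')"
    by (rule penalised_sumset_minimiser[OF A0(1) A0(1) refl, where w = "18 * real Q"]) blast
  have finAB: "finite A" "finite B" using AB A0 by (auto intro: finite_subset)
  define N where "N = card A"
  define k where "k = card A0 - N"
  have Nk: "N + k = L + card X"
    using card_mono[OF A0(1) AB(1)] cA0 by (simp add: k_def N_def)
  have "2 * N \<le> card (A + B) + 1"
  proof (cases "N = 0")
    case False
    then have "A \<noteq> {}" "B \<noteq> {}" using AB(3) by (auto simp: N_def)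
    then show ?thesis using card_set_plus_int_ge[OF finAB] AB(3) by (simp add: N_def)
  qed simp
  moreover have "real (card (A + B)) - 18 * real Q * real N
      \<le> real (card (A0 + A0)) - 18 * real Q * (real N + real k)"
    using minimal[of A0 A0] Nk cA0 by (simp add: N_def flip: of_nat_add)
  \<comment> \<open>With \<open>N = L + card X - k\<close>, the lower bound \<open>2 * N - 1\<close>
    for the sumset absorbs all but \<open>4 * M + 2 * k\<close> of the sums. The weight 18 is 16 +
    2: the 2 pays for \<open>2 * k\<close>, and the 16 turns \<open>4 * M = 4 * Q * card X\<close>
    into \<open>4 * k \<le> card X\<close>.\<close>
  ultimately have "18 * real Q * real k \<le> 4 * real M + 2 * real k"
    using sumA0 Nk cX unfolding distrib_left by linarith
  moreover have "2 * real k \<le> 2 * real Q * real k" using Q by (simp add: mult_right_mono)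
  ultimately have "real Q * (4 * real k) \<le> real Q * real (card X)"
    using X(4) by simp
  then have "4 * real k \<le> real (card X)" using Q by (simp add: mult_le_cancel_left)
  then have k: "4 * k \<le> card X" by linarith
  have "L \<le> N" using Nk k by simp
  \<comment> \<open>The points of \<open>Y\<close> surviving on both sides. At most
    \<open>2 * k\<close> are missing, so at least half of \<open>Y\<close> remains.\<close>
  define T where "T = A \<inter> B \<inter> Y"
  have "card T + 2 * k \<ge> card X"
  proof -
    have "card (A0 - A) = k" "card (A0 - B) = k"
      using AB finAB by (auto simp: card_Diff_subset k_def N_def)
    moreover have "card Y \<le> card (T \<union> ((A0 - A) \<union> (A0 - B)))"
      using A0 finAB by (intro card_mono) (auto simp: T_def A0_def)
    moreover have "\<dots> \<le> card T + card ((A0 - A) \<union> (A0 - B))" by (rule card_Un_le)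
    moreover have "card ((A0 - A) \<union> (A0 - B)) \<le> card (A0 - A) + card (A0 - B)" by (rule card_Un_le)
    ultimately show ?thesis using Y(2) by linarith
  qed
  then have T: "card X \<le> 2 * card T" using k by linarith
  have finT: "finite T" and TX: "card T \<le> card X"
    using card_mono[OF Y(1), of T] Y finAB by (auto simp: T_def)
  define \<Gamma> where "\<Gamma> = A \<times> B - (\<lambda>t. (t, t)) ` T"
  have "card \<Gamma> = card (A \<times> B) - card ((\<lambda>t. (t, t)) ` T)"
    unfolding \<Gamma>_def using finT by (intro card_Diff_subset) (auto simp: T_def)
  also have "card ((\<lambda>t. (t, t)) ` T) = card T" by (auto intro!: card_image inj_onI)
  finally have "real (card \<Gamma>) \<ge> (real N)\<^sup>2 - real (card T)"
    using AB(3) by (simp add: card_cartesian_product N_def power2_eq_square flip: of_nat_mult)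
  moreover have "real (card T) \<le> \<delta> * (real N)\<^sup>2"
  proof -
    have "\<delta> > 0" using \<delta> by (metis less_le_trans mult_nonpos_nonneg not_less of_nat_0_le_iff zero_less_one)
    have MN: "M \<le> N" "card T \<le> N" using M_le' \<open>L \<le> N\<close> TX cXM by linarith+
    then have "real (card T) \<le> 1 * real N" by simp
    also have "\<dots> \<le> (\<delta> * real M) * real N" using \<delta> by (intro mult_right_mono) auto
    also have "\<dots> \<le> (\<delta> * real N) * real N"
      using MN \<open>\<delta> > 0\<close> by (intro mult_right_mono mult_left_mono) auto
    finally show ?thesis by (simp add: power2_eq_square)
  qed
  ultimately have \<Gamma>: "\<Gamma> \<subseteq> A \<times> B" "real (card \<Gamma>) \<ge> (1 - \<delta>) * (real (card A))\<^sup>2"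
    by (auto simp: \<Gamma>_def N_def algebra_simps)
  have finAB': "finite (A + B)" using finAB by (rule finite_set_plus)
  have "restricted_sumset \<Gamma> \<subseteq> (A + B) - (\<lambda>t. 2 * t) ` T"
  proof
    fix s assume "s \<in> restricted_sumset \<Gamma>"
    then obtain a b where ab: "s = a + b" "(a, b) \<in> \<Gamma>" by (auto simp: restricted_sumset_def)
    then have mem: "a \<in> A" "b \<in> B" by (auto simp: \<Gamma>_def)
    have "s \<noteq> 2 * t" if "t \<in> T" for t
    proof
      assume "s = 2 * t"
      then have "a = t \<and> b = t"
        using unique[of a b t] ab(1) mem AB that by (auto simp: T_def)
      then show False using ab(2) that by (auto simp: \<Gamma>_def)
    qed
    then show "s \<in> (A + B) - (\<lambda>t. 2 * t) ` T" using ab(1) mem by (auto intro: set_plus_intro)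
  qed
  then have "card (restricted_sumset \<Gamma>) \<le> card ((A + B) - (\<lambda>t. 2 * t) ` T)"
    using finAB' by (intro card_mono) auto
  moreover have TAB: "(\<lambda>t. 2 * t) ` T \<subseteq> A + B"
  proof clarify
    fix t assume "t \<in> T"
    then have "t + t \<in> A + B" by (intro set_plus_intro) (auto simp: T_def)
    then show "2 * t \<in> A + B" by simp
  qed
  moreover have "card ((A + B) - (\<lambda>t. 2 * t) ` T) = card (A + B) - card ((\<lambda>t. 2 * t) ` T)"
    using finT TAB by (intro card_Diff_subset) auto
  moreover have cT: "card ((\<lambda>t. 2 * t) ` T) = card T" by (auto intro!: card_image inj_onI)
  ultimately have RS: "card (restricted_sumset \<Gamma>) \<le> card (A + B) - card T" by simp
  \<comment> \<open>This excludes truncation in the natural-number subtraction of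
    \<open>RS\<close>.\<close>
  have "card T \<le> card (A + B)" using card_mono[OF finAB' TAB] cT by simp
  with RS have RS': "real (card (restricted_sumset \<Gamma>)) + real (card T) \<le> real (card (A + B))"
    by linarith
  have "card (A + B) \<le> card (A0 + A0)"
    using A0 AB by (intro card_mono set_plus_mono2 finite_set_plus) auto
  then have "real (card (restricted_sumset \<Gamma>)) \<le> 2 * real L + 4 * real M"
    using RS sumA0 by linarith
  also have "\<dots> \<le> (2 + \<sigma>) * real L" using M_le by (simp add: algebra_simps)
  also have "\<dots> \<le> K * real N" using K \<open>L \<le> N\<close> by (intro mult_mono) auto
  finally have "real (card (restricted_sumset \<Gamma>)) \<le> K * real (card A)" by (simp add: N_def)
  from robust_regularity_equal_cards[OF reg finAB AB(3) \<Gamma> this]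
  obtain A' B' where A'B': "A' \<subseteq> A" "B' \<subseteq> B" "card A' = card B'"
    and large: "real (card A') \<ge> (1 - \<epsilon>) * real N"
    and small: "real (card (A' + B')) \<le> real (card (restricted_sumset \<Gamma>)) + \<epsilon> * real N"
    unfolding N_def by blast
  \<comment> \<open>Minimality says that losing at most \<open>\<epsilon> * N\<close> elements per
    side loses at most \<open>18 * Q * \<epsilon> * N\<close> sums. But \<open>A' + B'\<close> has
    at most \<open>\<epsilon> * N\<close> more sums than \<open>\<Gamma>\<close>, which misses at
    least \<open>card T\<close> of them.\<close>
  have "real (card (A + B)) - 18 * real Q * real N \<le> real (card (A' + B')) - 18 * real Q * real (card A')"
    using minimal[of A' B'] A'B' AB by (auto simp: N_def)
  moreover have "18 * real Q * ((1 - \<epsilon>) * real N) \<le> 18 * real Q * real (card A')"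
    using large by (intro mult_left_mono) auto
  ultimately have "real (card T) \<le> 18 * real Q * (\<epsilon> * real N) + 1 * (\<epsilon> * real N)"
    using small RS' by (simp add: algebra_simps)
  also have "\<dots> \<le> 18 * real Q * (\<epsilon> * real N) + real Q * (\<epsilon> * real N)"
    using Q \<epsilon> by (intro add_left_mono mult_right_mono) auto
  also have "\<dots> = 19 * real Q * (\<epsilon> * real N)" by simp
  also have "\<dots> \<le> 19 * real Q * (\<epsilon> * (6 * real M / \<sigma>))"
  proof -
    have "real N \<le> 4 * real M / \<sigma> + 1 + real M" using Nk L(2) cXM by linarith
    also have "\<dots> \<le> 6 * real M / \<sigma>" using M\<sigma> unfolding times_divide_eq_right[symmetric] by linarith
    finally show ?thesis using \<epsilon> by (intro mult_left_mono) auto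
  qed
  \<comment> \<open>Here 114 = 19 * 6, and 114 / 256 < 1 / 2 contradicts \<open>T\<close>.\<close>
  also have "\<dots> = 114 * ((real Q)\<^sup>2 * \<epsilon>) * real (card X) / \<sigma>"
    using X(4) by (simp add: power2_eq_square)
  also have "\<dots> \<le> 114 * (\<sigma> / 256) * real (card X) / \<sigma>"
    using \<epsilon> K by (intro divide_right_mono mult_right_mono mult_left_mono) auto
  also have "\<dots> < real (card X) / 2" using K cX by simp
  finally show False using T by linarith
qed

section \<open>Choice of parameters and the final bound\<close>

text \<open>With \<open>d\<close> near \<open>x / 16\<close> and \<open>n\<close> near
  \<open>exp (x / 16)\<close>, the logarithm of the inverse density
  \<open>2 ^ d * (d * n\<^sup>2 + 1)\<close> is linear in \<open>x\<close>, while that of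
  \<open>n ^ d\<close> is quadratic. For \<open>x \<ge> 32\<close> rounding down still leaves
  \<open>d \<ge> x / 32\<close> and \<open>n \<ge> exp (x / 32)\<close>, whence 1024 = 32 *
  32.\<close>

lemma behrend_parameters:
  fixes x :: real
  assumes "x \<ge> 32"
  obtains n d :: nat where "n \<ge> 1" "256 * (real (2 ^ d * (d * n\<^sup>2 + 1)))\<^sup>2 \<le> exp x"
    "exp (x\<^sup>2 / 1024) \<le> real (n ^ d)"
proof -
  define d where "d = nat \<lfloor>x / 16\<rfloor>"
  define n where "n = nat \<lfloor>exp (x / 16)\<rfloor>"
  have d: "real d \<le> x / 16" "x / 32 \<le> real d" using assms unfolding d_def by linarith+
  have e: "exp (x / 32) \<ge> 2" using exp_ge_add_one_self[of "x / 32"] assms by linarith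
  have "exp (x / 16) = exp (x / 32) * exp (x / 32)" by (simp flip: exp_add)
  moreover have "2 * exp (x / 32) \<le> exp (x / 32) * exp (x / 32)" using e by (intro mult_right_mono) auto
  ultimately have e': "exp (x / 32) \<le> exp (x / 16) - 1" using e by linarith
  have n: "real n \<le> exp (x / 16)" "exp (x / 32) \<le> real n"
    using e' e unfolding n_def by linarith+
  have "real (2 ^ d * (d * n\<^sup>2 + 1)) \<le> exp (x / 16) * exp (x / 16 + 2 * (x / 16))"
  proof -
    have "(2::real) ^ d \<le> exp 1 ^ d"
      using exp_ge_add_one_self[of 1] by (intro power_mono) auto
    also have "\<dots> = exp (real d)" by (simp flip: exp_of_nat_mult)
    also have "\<dots> \<le> exp (x / 16)" using d by simp
    finally have 1: "(2::real) ^ d \<le> exp (x / 16)" .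
    have "(real n)\<^sup>2 \<le> (exp (x / 16))\<^sup>2" using n by (intro power_mono) auto
    then have "(real n)\<^sup>2 \<le> exp (2 * (x / 16))" by (simp flip: exp_of_nat_mult)
    then have "real d * (real n)\<^sup>2 + 1 \<le> x / 16 * exp (2 * (x / 16)) + exp (2 * (x / 16))"
      using d assms by (intro add_mono mult_mono) auto
    also have "\<dots> = (1 + x / 16) * exp (2 * (x / 16))" by (simp add: algebra_simps)
    also have "\<dots> \<le> exp (x / 16) * exp (2 * (x / 16))"
      by (intro mult_right_mono exp_ge_add_one_self) auto
    finally have 2: "real d * (real n)\<^sup>2 + 1 \<le> exp (x / 16 + 2 * (x / 16))" by (simp only: exp_add)
    show ?thesis using mult_mono[OF 1 2] unfolding of_nat_mult of_nat_add of_nat_power by simp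
  qed
  also have "\<dots> = exp (x / 4)" by (simp flip: exp_add)
  finally have "(real (2 ^ d * (d * n\<^sup>2 + 1)))\<^sup>2 \<le> (exp (x / 4))\<^sup>2" by (intro power_mono) auto
  also have "\<dots> = exp (x / 2)" by (simp flip: exp_of_nat_mult)
  finally have "256 * (real (2 ^ d * (d * n\<^sup>2 + 1)))\<^sup>2 \<le> 2 ^ 8 * exp (x / 2)" by simp
  \<comment> \<open>The constant 256 costs only \<open>exp (x / 4)\<close>, which fits beside
    \<open>exp (x / 2)\<close>.\<close>
  also have "(2::real) ^ 8 \<le> exp (x / 32) ^ 8" using e by (intro power_mono) auto
  also have "\<dots> * exp (x / 2) = exp (x * 3 / 4)" by (simp flip: exp_of_nat_mult exp_add)
  also have "\<dots> \<le> exp x" using assms by simp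
  finally have Q: "256 * (real (2 ^ d * (d * n\<^sup>2 + 1)))\<^sup>2 \<le> exp x" by simp
  have "x\<^sup>2 / 1024 = x / 32 * (x / 32)" by (simp add: power2_eq_square)
  also have "\<dots> \<le> real d * (x / 32)" using d assms by (intro mult_right_mono) auto
  finally have "exp (x\<^sup>2 / 1024) \<le> exp (x / 32) ^ d" by (simp flip: exp_of_nat_mult)
  also have "\<dots> \<le> real n ^ d" using n by (intro power_mono) auto
  finally have "exp (x\<^sup>2 / 1024) \<le> real (n ^ d)" by simp
  moreover have "n \<ge> 1" using n e by linarith
  ultimately show ?thesis using Q that by blast
qed

text \<open>The parameters are taken at \<open>x = ln D\<close> and
  \<open>\<sigma> = min (K - 2) 1\<close>. As \<open>D = \<sigma> / \<epsilon>\<close>, the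
  condition \<open>256 * q\<^sup>2 \<le> D\<close> is the one required of \<open>\<epsilon>\<close>;
  a larger \<open>\<delta>\<close> would satisfy \<open>1 \<le> \<delta> * M\<close>, since
  \<open>M \<ge> card X\<close>.\<close>

lemma robust_regularity_delta_le:
  fixes K \<epsilon> D \<delta> :: real
  assumes "K > 2" "\<epsilon> > 0" "D = inverse \<epsilon> * min (K - 2) 1" "D \<ge> exp 32"
    and reg: "robust_regularity K \<epsilon> \<delta>"
  shows "\<delta> \<le> exp (- ((ln D)\<^sup>2 / 1024))"
proof (rule ccontr)
  assume "\<not> ?thesis"
  then have \<delta>: "\<delta> > exp (- ((ln D)\<^sup>2 / 1024))" by simp
  then have "\<delta> > 0" using exp_gt_zero less_trans by blast
  have "D > 0" using assms(4) exp_gt_zero[of "32::real"] by linarith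
  then have "ln D \<ge> 32" using assms(4) by (simp add: ln_ge_iff)
  then obtain n d where n: "n \<ge> 1" and Q: "256 * (real (2 ^ d * (d * n\<^sup>2 + 1)))\<^sup>2 \<le> exp (ln D)"
    and M: "exp ((ln D)\<^sup>2 / 1024) \<le> real (n ^ d)"
    using behrend_parameters by blast
  define q where "q = 2 ^ d * (d * n\<^sup>2 + 1)"
  obtain X where X: "finite X" "card X = n ^ d"
    "X \<subseteq> {0..<int ((2 * n) ^ d * (d * n\<^sup>2 + 1))}"
    "\<And>x y z. x \<in> X \<Longrightarrow> y \<in> X \<Longrightarrow> z \<in> X \<Longrightarrow> x + y = 2 * z \<Longrightarrow> x = y"
    using behrend_set[of n d] by blast
  have eq: "(2 * n) ^ d * (d * n\<^sup>2 + 1) = q * card X"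
    by (simp add: X(2) q_def power_mult_distrib algebra_simps)
  have "q \<ge> 1" using n by (simp add: q_def Suc_le_eq)
  then have le: "real (n ^ d) \<le> real (q * card X)" unfolding X(2) of_nat_le_iff by simp
  have "1 = exp (- ((ln D)\<^sup>2 / 1024)) * exp ((ln D)\<^sup>2 / 1024)" by (simp flip: exp_add)
  also have "\<dots> \<le> \<delta> * real (q * card X)"
    using \<delta> M le \<open>\<delta> > 0\<close> by (intro mult_mono) auto
  finally have "1 \<le> \<delta> * real (q * card X)" .
  moreover have "X \<noteq> {}" using X(2) n by auto
  moreover have "256 * (real q)\<^sup>2 * \<epsilon> \<le> min (K - 2) 1"
    using Q \<open>D > 0\<close> assms(2,3) by (simp add: q_def field_simps)
  ultimately have "\<not> robust_regularity K \<epsilon> \<delta>"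
    using X(1,3) assms(1,2) unfolding eq
    by (intro not_robust_regularity[OF _ _ _ refl X(4), where \<sigma> = "min (K - 2) 1"]) auto
  with reg show False by contradiction
qed

theorem theorem1p4:
  shows "\<exists>(c::real) (D\<^sub>0::real). c > 0 \<and>
    (\<forall>(K::real) (\<epsilon>::real) (D::real) (\<delta>::real).
       K > 2 \<longrightarrow> 0 < \<epsilon> \<longrightarrow> \<epsilon> < 1 / 2 \<longrightarrow>
       D = inverse \<epsilon> * min (K - 2) 1 \<longrightarrow> D \<ge> D\<^sub>0 \<longrightarrow> \<delta> > 0 \<longrightarrow>
       (\<forall>(N::nat) (A::int set) (B::int set) (\<Gamma>::(int \<times> int) set).
          finite A \<longrightarrow> finite B \<longrightarrow> card A = N \<longrightarrow> card B = N \<longrightarrow>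
          \<Gamma> \<subseteq> A \<times> B \<longrightarrow>
          real (card \<Gamma>) \<ge> (1 - \<delta>) * (real N)\<^sup>2 \<longrightarrow>
          real (card (restricted_sumset \<Gamma>)) \<le> K * real N \<longrightarrow>
          (\<exists>A' B'. A' \<subseteq> A \<and> B' \<subseteq> B \<and>
             real (card A') \<ge> (1 - \<epsilon>) * real N \<and>
             real (card B') \<ge> (1 - \<epsilon>) * real N \<and>
             real (card (A' + B')) \<le> real (card (restricted_sumset \<Gamma>)) + \<epsilon> * real N)) \<longrightarrow>
       \<delta> \<le> exp (- c * (ln D)\<^sup>2 / (ln (ln D))\<^sup>2))"
proof (rule exI[of _ "1 / 1024"], rule exI[of _ "exp 32"], intro conjI allI impI, goal_cases)
  case (2 K \<epsilon> D \<delta>)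
  have "D > 0" using 2(5) exp_gt_zero[of "32::real"] by linarith
  then have x: "ln D \<ge> 32" using 2(5) by (simp add: ln_ge_iff)
  \<comment> \<open>Once \<open>ln (ln D) \<ge> 1\<close>, dividing the exponent by its square only
    weakens the bound already proved.\<close>
  have "exp 1 \<le> ln D" using exp_le x by linarith
  then have "ln (ln D) \<ge> 1" using x by (simp add: ln_ge_iff)
  then have "(ln (ln D))\<^sup>2 \<ge> 1" by (rule one_le_power)
  then have "(ln D)\<^sup>2 / (ln (ln D))\<^sup>2 \<le> (ln D)\<^sup>2 / 1" by (intro divide_left_mono) auto
  then have "- ((ln D)\<^sup>2 / 1024) \<le> - (1 / 1024) * (ln D)\<^sup>2 / (ln (ln D))\<^sup>2" by simp
  moreover have "\<delta> \<le> exp (- ((ln D)\<^sup>2 / 1024))"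
    using 2 by (intro robust_regularity_delta_le[of K \<epsilon>]) (auto simp: robust_regularity_def)
  ultimately show ?case by (meson exp_le_cancel_iff order_trans)
qed simp

end
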